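(* Let $\theta\in\mathbb{R}$ with $|\theta|<\pi/2$, let $\gamma>0$, and let $f\in\mathcal{C}_\theta(\gamma)$. Then $$\sup_{z\in\mathbb{D}}(1-|z|^2)\,|zP_f(z)|\le 2\gamma\cos\theta.$$ Consequently, if $2\gamma\cos\theta\le 1$, then every $f\in\mathcal{C}_\theta(\gamma)$ is univalent in $\mathbb{D}$; in particular, for $\theta=0$, every $f\in\mathcal{C}_0(\gamma)$ is univalent in $\mathbb{D}$ provided that $\gamma\le 1/2$.
   Context: $\mathbb{D}=\{z\in\mathbb{C}:|z|<1\}$. $\mathcal{A}$ is the class of analytic functions $f$ in $\mathbb{D}$ with $f(0)=f'(0)-1=0$. For $|\theta|<\pi/2$ and $\gamma>0$, $\mathcal{C}_\theta(\gamma)$ is the class of all $f\in\mathcal{A}$ (with $f'$ non-vanishing in $\mathbb{D}$) such that $$\operatorname{Re}\left(e^{i\theta}\left(1+\frac{zf''(z)}{f'(z)}\right)\right)<\left(1+\frac{\gamma}{2}\right)\cos\theta\quad\text{for all } z\in\mathbb{D}.$$ The pre-Schwarzian derivative of a locally univalent analytic function $f$ is $P_f=f''/f'$. Univalent means injective. *)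

theory Defs
  imports "HOL-Complex_Analysis.Complex_Analysis"
begin

abbreviation unit_disc :: "complex set" where
  "unit_disc \<equiv> ball 0 1"

definition class_A :: "(complex \<Rightarrow> complex) set" where
  "class_A = {f. f holomorphic_on unit_disc \<and> f 0 = 0 \<and> deriv f 0 - 1 = 0}"

definition pre_Schwarzian :: "(complex \<Rightarrow> complex) \<Rightarrow> complex \<Rightarrow> complex" where
  "pre_Schwarzian f z = deriv (deriv f) z / deriv f z"

definition class_C :: "real \<Rightarrow> real \<Rightarrow> (complex \<Rightarrow> complex) set" where
  "class_C \<theta> \<gamma> = {f \<in> class_A.
     (\<forall>z\<in>unit_disc. deriv f z \<noteq> 0) \<and>
     (\<forall>z\<in>unit_disc. Re (exp (\<i> * of_real \<theta>) * (1 + z * deriv (deriv f) z / deriv f z))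
        < (1 + \<gamma> / 2) * cos \<theta>)}"

end

(* The half-plane condition bounds Re (e^(i theta) z P_f(z)) by gamma cos(theta) / 2, so the
   Schwarz lemma (in Borel-Caratheodory form) yields the estimate for (1 - |z|^2) |z P_f(z)|.
   Univalence is Becker's criterion, proved by Ahlfors' explicit extension: for f analytic past
   the unit circle, f is continued to |z| > 1 by f(q) + (z - q) f'(q) with q = 1 / cnj z.
   The result is C^1 on the plane, and the criterion says precisely that its Beltrami
   coefficient has modulus < 1, so it is a proper local homeomorphism that is asymptotic to an
   affine map at infinity; such a map is injective. For general f one uses f(r z) with r < 1. *)

theory Submission
  imports Defs
begin

section \<open>From local to global injectivity\<close>

text \<open>Having at least two preimages is both an open and a closed condition on the value, so by
  connectedness a single value \<open>w\<close> that is not taken twice rules out all repeated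
  values.\<close>

lemma proper_locally_injective_imp_inj:
  fixes F :: "'a::euclidean_space \<Rightarrow> 'a"
  assumes cont: "continuous_on UNIV F"
    and loc: "\<And>z. \<exists>r>0. inj_on F (ball z r)"
    and proper: "\<And>C. bounded {z. norm (F z) \<le> C}"
    and uniq: "\<And>x y. F x = w \<Longrightarrow> F y = w \<Longrightarrow> x = y"
  shows "inj F"
proof -
  \<comment> \<open>\<open>M\<close> is open by invariance of domain, and closed by properness and local injectivity.\<close>
  define M where "M = {v. \<exists>x y. x \<noteq> y \<and> F x = v \<and> F y = v}"
  have "open M"
  proof (subst open_subopen, intro ballI)
    fix v assume "v \<in> M"
    then obtain x y where xy: "x \<noteq> y" "F x = v" "F y = v"
      by (auto simp: M_def)
    obtain U V where UV: "open U" "open V" "x \<in> U" "y \<in> V" "U \<inter> V = {}"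
      using separation_t2[of x y] xy(1) by blast
    obtain r where r: "r > 0" "inj_on F (ball x r)" using loc by blast
    obtain s where s: "s > 0" "inj_on F (ball y s)" using loc by blast
    have "open (F ` (U \<inter> ball x r))" "open (F ` (V \<inter> ball y s))"
      using UV r s cont
      by (auto intro!: invariance_of_domain open_Int
            intro: continuous_on_subset inj_on_subset)
    then have "open (F ` (U \<inter> ball x r) \<inter> F ` (V \<inter> ball y s))"
      by blast
    moreover have "v \<in> F ` (U \<inter> ball x r)"
      using UV(3) r(1) xy(2) by (intro image_eqI[where x = x]) auto
    moreover have "v \<in> F ` (V \<inter> ball y s)"
      using UV(4) s(1) xy(3) by (intro image_eqI[where x = y]) auto
    moreover have "F ` (U \<inter> ball x r) \<inter> F ` (V \<inter> ball y s) \<subseteq> M"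
    proof
      fix t assume "t \<in> F ` (U \<inter> ball x r) \<inter> F ` (V \<inter> ball y s)"
      then obtain p q where pq: "p \<in> U" "q \<in> V" "F p = t" "F q = t" by auto
      then have "p \<noteq> q" using UV(5) by blast
      then show "t \<in> M" using pq(3,4) by (auto simp: M_def)
    qed
    ultimately show "\<exists>T. open T \<and> v \<in> T \<and> T \<subseteq> M"
      by (intro exI[of _ "F ` (U \<inter> ball x r) \<inter> F ` (V \<inter> ball y s)"]) blast
  qed
  moreover have "closed M"
    unfolding closed_sequential_limits
  proof (intro allI impI)
    fix v l assume "(\<forall>n. v n \<in> M) \<and> v \<longlonglongrightarrow> l"
    then have vM: "\<And>n. \<exists>x y. x \<noteq> y \<and> F x = v n \<and> F y = v n" and vl: "v \<longlonglongrightarrow> l"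
      by (auto simp: M_def)
    then obtain x y where xy: "\<And>n. x n \<noteq> y n" "\<And>n. F (x n) = v n" "\<And>n. F (y n) = v n"
      by metis
    obtain C where "\<And>n. norm (v n) \<le> C"
      using convergent_imp_Bseq[of v] vl unfolding convergent_def Bseq_def by blast
    then have "range (\<lambda>n. (x n, y n)) \<subseteq> {z. norm (F z) \<le> C} \<times> {z. norm (F z) \<le> C}"
      using xy by auto
    then have "bounded (range (\<lambda>n. (x n, y n)))"
      using proper bounded_Times bounded_subset by metis
    \<comment> \<open>Working with pairs lets one subsequence serve both families of
      preimages.\<close>
    then obtain p \<sigma> where \<sigma>: "strict_mono \<sigma>" and p: "((\<lambda>n. (x n, y n)) \<circ> \<sigma>) \<longlonglongrightarrow> p"
      using bounded_imp_convergent_subsequence by blast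
    have lim: "(\<lambda>n. x (\<sigma> n)) \<longlonglongrightarrow> fst p" "(\<lambda>n. y (\<sigma> n)) \<longlonglongrightarrow> snd p"
      using tendsto_fst[OF p] tendsto_snd[OF p] by (auto simp: o_def)
    have vl': "(\<lambda>n. v (\<sigma> n)) \<longlonglongrightarrow> l"
      using LIMSEQ_subseq_LIMSEQ[OF vl \<sigma>] by (simp add: o_def)
    have Fl: "F (fst p) = l" "F (snd p) = l"
      using continuous_on_tendsto_compose[OF cont lim(1)]
            continuous_on_tendsto_compose[OF cont lim(2)] xy vl'
      by (auto intro: LIMSEQ_unique)
    \<comment> \<open>If the two limits coincided, both preimages would eventually lie in one ball
      on which \<open>F\<close> is injective.\<close>
    have "fst p \<noteq> snd p"
    proof
      assume eq: "fst p = snd p"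
      obtain r where r: "r > 0" "inj_on F (ball (fst p) r)" using loc by blast
      have "\<forall>\<^sub>F n in sequentially. x (\<sigma> n) \<in> ball (fst p) r"
        "\<forall>\<^sub>F n in sequentially. y (\<sigma> n) \<in> ball (fst p) r"
        using tendstoD[OF lim(1) r(1)] tendstoD[OF lim(2) r(1)] by (simp_all add: eq dist_commute)
      then have "\<forall>\<^sub>F n in sequentially. False"
        by eventually_elim (metis inj_onD r(2) xy)
      then show False by simp
    qed
    then show "l \<in> M" using Fl by (auto simp: M_def)
  qed
  moreover have "w \<notin> M" using uniq by (auto simp: M_def)
  ultimately have "M = {}" using clopen[of M] by auto
  then show ?thesis unfolding M_def inj_def by (metis (mono_tags, lifting) empty_Collect_eq)
qed

text \<open>The real-linear map \<open>h\<close> to \<open>A z * h + B z * cnj h\<close> has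
  determinant |A z|^2 - |B z|^2, which is positive here. It is therefore invertible, and continuity
  of \<open>A\<close> and \<open>B\<close> permits the inverse function theorem.\<close>

lemma locally_injective_if_beltrami_less:
  fixes F A B :: "complex \<Rightarrow> complex"
  assumes der: "\<And>z. (F has_derivative (\<lambda>h. A z * h + B z * cnj h)) (at z)"
    and contA: "continuous_on UNIV A" and contB: "continuous_on UNIV B"
    and less: "cmod (B z) < cmod (A z)"
  shows "\<exists>r>0. inj_on F (ball z r)"
proof -
  define D where "D = A z * cnj (A z) - B z * cnj (B z)"
  \<comment> \<open>This is the inverse of the derivative at \<open>z\<close>, found by eliminating
    \<open>cnj h\<close> between the equation and its conjugate; \<open>D\<close> is the
    determinant.\<close>
  define g where "g = (\<lambda>w. (cnj (A z) * w - B z * cnj w) / D)"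
  have "D = of_real ((cmod (A z))\<^sup>2 - (cmod (B z))\<^sup>2)"
    by (simp add: D_def complex_norm_square del: of_real_power)
  moreover have "(cmod (B z))\<^sup>2 < (cmod (A z))\<^sup>2"
    using less by (intro power_strict_mono) auto
  ultimately have D0: "D \<noteq> 0" by (metis less_irrefl of_real_eq_0_iff right_minus_eq)
  have "cnj D = D" by (simp add: D_def)
  have blg: "bounded_linear g"
    unfolding g_def divide_inverse
    by (intro bounded_linear_mult_const bounded_linear_sub bounded_linear_mult_right
          bounded_linear_compose[OF bounded_linear_mult_right bounded_linear_cnj])
  have inv: "g \<circ> (\<lambda>h. A z * h + B z * cnj h) = id"
  proof
    fix h
    have "cnj (A z) * (A z * h + B z * cnj h) - B z * cnj (A z * h + B z * cnj h) = D * h"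
      by (simp add: D_def algebra_simps)
    then show "(g \<circ> (\<lambda>h. A z * h + B z * cnj h)) h = id h"
      using D0 by (simp add: g_def)
  qed
  \<comment> \<open>The derivative depends continuously on the point in operator norm: the C^1
    hypothesis of the inverse function theorem.\<close>
  have on: "\<exists>d>0. \<forall>x. dist z x < d \<longrightarrow>
      onorm (\<lambda>v. (A x * v + B x * cnj v) - (A z * v + B z * cnj v)) < e" if "e > 0" for e
  proof -
    have "isCont A z" "isCont B z"
      using contA contB by (auto simp: continuous_on_eq_continuous_at)
    then have "isCont (\<lambda>x. cmod (A x - A z) + cmod (B x - B z)) z"
      by (intro continuous_intros)
    then obtain d where "d > 0" and
      d: "\<And>x. dist x z < d \<Longrightarrow> cmod (A x - A z) + cmod (B x - B z) < e"
      using \<open>e > 0\<close> unfolding continuous_at_eps_delta by (force simp: dist_real_def)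
    show ?thesis
    proof (intro exI[of _ d] conjI allI impI \<open>d > 0\<close>)
      fix x assume "dist z x < d"
      have "onorm (\<lambda>v. (A x * v + B x * cnj v) - (A z * v + B z * cnj v))
              \<le> cmod (A x - A z) + cmod (B x - B z)"
      proof (rule onorm_le)
        fix v
        have "cmod ((A x * v + B x * cnj v) - (A z * v + B z * cnj v))
                = cmod ((A x - A z) * v + (B x - B z) * cnj v)"
          by (simp add: algebra_simps)
        also have "\<dots> \<le> (cmod (A x - A z) + cmod (B x - B z)) * cmod v"
          by (rule order_trans[OF norm_triangle_ineq]) (simp add: norm_mult distrib_right)
        finally show "cmod ((A x * v + B x * cnj v) - (A z * v + B z * cnj v))
          \<le> (cmod (A x - A z) + cmod (B x - B z)) * cmod v" .
      qed
      then show "onorm (\<lambda>v. (A x * v + B x * cnj v) - (A z * v + B z * cnj v)) < e"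
        using d[of x] \<open>dist z x < d\<close> by (simp add: dist_commute)
    qed
  qed
  show ?thesis
    by (rule has_derivative_locally_injective[of z UNIV g
          "\<lambda>z h. A z * h + B z * cnj h" F]) (use blg inv der on in auto)
qed

section \<open>The Ahlfors extension and its Beltrami coefficient\<close>

text \<open>Outside the closed disc this is inversion in the unit circle. Taking the identity inside
  gives a continuous retraction onto the closed disc, so one formula can describe both
  \<open>f\<close> and its extension.\<close>

definition disc_reflection :: "complex \<Rightarrow> complex" where
  "disc_reflection z = (if z \<in> cball 0 1 then z else inverse (cnj z))"

text \<open>On the closed disc the second summand vanishes and this is \<open>f\<close>. Outside, it
  is the first-order Taylor polynomial of \<open>f\<close> at the reflected point, evaluated at
  \<open>z\<close>.\<close>

definition ahlfors_extension :: "(complex \<Rightarrow> complex) \<Rightarrow> complex \<Rightarrow> complex" where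
  "ahlfors_extension f z =
     f (disc_reflection z) + (z - disc_reflection z) * deriv f (disc_reflection z)"

lemma norm_disc_reflection_le: "cmod (disc_reflection z) \<le> 1"
  by (auto simp: disc_reflection_def norm_inverse inverse_le_1_iff)

lemma continuous_on_disc_reflection: "continuous_on UNIV disc_reflection"
proof -
  have 1: "(UNIV::complex set) = cball 0 1 \<union> - ball 0 1" by auto
  have eq: "inverse (cnj z) = z" if "cmod z = 1" for z
    using that by (metis complex_mod_cnj complex_norm_square inverse_unique mult.commute
        of_real_1 power_one)
  have "continuous_on (cball 0 1 \<union> - ball 0 1) disc_reflection"
    unfolding disc_reflection_def
    by (rule continuous_on_cases) (auto intro!: continuous_intros simp: eq)
  then show ?thesis using 1 by simp
qed

text \<open>Outside the disc, with q = 1 / cnj z, the terms f'(q) dq from f(q) and from (z - q)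
  f'(q) cancel, and dq = - q^2 cnj h gives the remaining antilinear part. That part carries the
  factor z - q, which vanishes on the circle, so the two formulas fit together to first
  order.\<close>

lemma ahlfors_extension_has_derivative:
  assumes holf: "f holomorphic_on ball 0 R" and "R > 1"
  defines "p \<equiv> disc_reflection"
  shows "(ahlfors_extension f has_derivative
    (\<lambda>h. deriv f (p z) * h + (- (z - p z) * deriv (deriv f) (p z) * (p z)\<^sup>2) * cnj h)) (at z)"
proof -
  let ?c = "\<lambda>z. inverse (cnj z)"
  let ?G = "\<lambda>z. f (?c z) + (z - ?c z) * deriv f (?c z)"
  let ?G' = "\<lambda>z h. deriv f (?c z) * h + (- (z - ?c z) * deriv (deriv f) (?c z) * (?c z)\<^sup>2) * cnj h"
  have holf': "deriv f holomorphic_on ball 0 R"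
    using holf by (simp add: holomorphic_deriv)
  have df: "(f has_field_derivative deriv f x) (at x)"
    and df': "(deriv f has_field_derivative deriv (deriv f) x) (at x)" if "cmod x \<le> 1" for x
    using that holf holf' \<open>R > 1\<close> by (auto intro!: holomorphic_derivI[where S = "ball 0 R"])
  have inner: "(f has_derivative (\<lambda>h. deriv f x * h)) (at x)" if "cmod x \<le> 1" for x
    using df[OF that] by (simp add: has_field_derivative_def)
  have outer: "(?G has_derivative ?G' x) (at x)" if "cmod x \<ge> 1" for x
  proof -
    have x0: "x \<noteq> 0" using that by auto
    have cx: "cmod (?c x) \<le> 1" using that by (simp add: norm_inverse inverse_le_1_iff)
    have dc: "(?c has_derivative (\<lambda>h. - (?c x)\<^sup>2 * cnj h)) (at x)"
      using x0 by (auto intro!: derivative_eq_intros has_derivative_cnj simp: power2_eq_square)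
    have 1: "((\<lambda>z. f (?c z)) has_derivative (\<lambda>h. deriv f (?c x) * (- (?c x)\<^sup>2 * cnj h))) (at x)"
      using has_derivative_compose[OF dc df[OF cx, unfolded has_field_derivative_def]] .
    have 2: "((\<lambda>z. deriv f (?c z)) has_derivative
              (\<lambda>h. deriv (deriv f) (?c x) * (- (?c x)\<^sup>2 * cnj h))) (at x)"
      using has_derivative_compose[OF dc df'[OF cx, unfolded has_field_derivative_def]] .
    show ?thesis
      by (rule has_derivative_eq_rhs[OF has_derivative_add[OF 1 has_derivative_mult[OF
            has_derivative_diff[OF has_derivative_ident dc] 2]]])
        (simp add: algebra_simps fun_eq_iff)
  qed
  have refl: "?c x = x" if "cmod x = 1" for x
    using that by (metis complex_mod_cnj complex_norm_square inverse_unique mult.commute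
        of_real_1 power_one)
  have cl: "closure (- cball (0::complex) 1) = - ball 0 1"
    by (simp add: closure_complement)
  \<comment> \<open>Gluing along the circle: it lies in the closure of both pieces, and there both
    values and derivatives agree because q = z.\<close>
  have "((\<lambda>x. if x \<in> cball 0 1 then f x else ?G x) has_derivative
      (if z \<in> cball 0 1 then (\<lambda>x h. deriv f x * h) z else ?G' z)) (at z within (cball 0 1 \<union> - cball 0 1))"
  proof (rule has_derivative_If_within_closures, goal_cases)
    case 1
    then show ?case by (auto intro!: has_derivative_at_withinI[OF inner])
  next
    case 2
    then have "cmod z \<ge> 1" unfolding cl by auto
    then show ?case by (rule has_derivative_at_withinI[OF outer])
  next
    case 3
    then have "cmod z = 1" unfolding cl by auto
    then show ?case by (simp only: refl) simp
  next
    case 4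
    then have "cmod z = 1" unfolding cl by auto
    then show ?case by (simp only: refl) simp
  qed simp
  moreover have "(\<lambda>x. if x \<in> cball 0 1 then f x else ?G x) = ahlfors_extension f"
    by (auto simp: ahlfors_extension_def disc_reflection_def fun_eq_iff)
  moreover have "(if z \<in> cball 0 1 then (\<lambda>x h. deriv f x * h) z else ?G' z) =
    (\<lambda>h. deriv f (p z) * h + (- (z - p z) * deriv (deriv f) (p z) * (p z)\<^sup>2) * cnj h)"
    by (auto simp: p_def disc_reflection_def)
  ultimately show ?thesis by simp
qed

text \<open>With q = 1 / cnj z one has (z - q) cnj q = 1 - |q|^2. This turns the modulus of the
  antilinear coefficient into the expression of Becker's criterion at q.\<close>

lemma norm_diff_disc_reflection:
  assumes "cmod z > 1"
  shows "cmod (z - disc_reflection z) * (cmod (disc_reflection z))\<^sup>2 =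
    (1 - (cmod (disc_reflection z))\<^sup>2) * cmod (disc_reflection z)"
proof -
  define q where "q = disc_reflection z"
  have q: "q = inverse (cnj z)" using assms by (simp add: q_def disc_reflection_def)
  have z0: "z \<noteq> 0" using assms by auto
  have "(z - q) * cnj q = of_real (1 - (cmod q)\<^sup>2)"
    using z0 complex_norm_square[of q] by (simp add: q algebra_simps)
  then have "cmod (z - q) * cmod q = \<bar>1 - (cmod q)\<^sup>2\<bar>"
    by (metis complex_mod_cnj norm_mult norm_of_real)
  moreover have "(cmod q)\<^sup>2 \<le> 1"
    using norm_disc_reflection_le[of z] by (simp add: q_def power_le_one)
  ultimately show ?thesis
    by (simp add: q_def[symmetric] power2_eq_square mult.assoc[symmetric])
qed

text \<open>The strict inequality at the reflected point gives local injectivity outside the closed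
  disc; inside, the antilinear part is zero and \<open>nz\<close> suffices. Near infinity the
  extension differs from a linear map by a bounded function, which yields properness and a value
  with at most one preimage.\<close>

lemma inj_ahlfors_extension:
  assumes holf: "f holomorphic_on ball 0 R" and "R > 1"
    and nz: "\<And>z. cmod z \<le> 1 \<Longrightarrow> deriv f z \<noteq> 0"
    and less: "\<And>z. cmod z < 1 \<Longrightarrow>
      (1 - (cmod z)\<^sup>2) * cmod (z * deriv (deriv f) z) < cmod (deriv f z)"
  shows "inj (ahlfors_extension f)"
proof -
  define p where "p = disc_reflection"
  define F where "F = ahlfors_extension f"
  define A where "A = (\<lambda>z. deriv f (p z))"
  define B where "B = (\<lambda>z. - (z - p z) * deriv (deriv f) (p z) * (p z)\<^sup>2)"
  \<comment> \<open>The linear coefficient at infinity: as |z| grows, \<open>p z\<close> tends to 0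
    and \<open>A z\<close> to \<open>a\<close>.\<close>
  define a where "a = deriv f 0"
  have a0: "a \<noteq> 0" using nz[of 0] by (simp add: a_def)
  have holf': "deriv f holomorphic_on ball 0 R" and holf'': "deriv (deriv f) holomorphic_on ball 0 R"
    using holf by (simp_all add: holomorphic_deriv)
  have sub: "cball 0 1 \<subseteq> ball (0::complex) R" using \<open>R > 1\<close> by auto
  have cont: "continuous_on (cball 0 1) f" "continuous_on (cball 0 1) (deriv f)"
    "continuous_on (cball 0 1) (deriv (deriv f))"
    using holf holf' holf'' sub holomorphic_on_imp_continuous_on continuous_on_subset by blast+
  have contp: "continuous_on UNIV p"
    by (simp add: p_def continuous_on_disc_reflection)
  have p1: "cmod (p z) \<le> 1" for z by (simp add: p_def norm_disc_reflection_le)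
  have pin: "p ` UNIV \<subseteq> cball 0 1" using p1 by auto
  have contA: "continuous_on UNIV A"
    unfolding A_def by (rule continuous_on_compose2[OF cont(2) contp pin])
  have contB: "continuous_on UNIV B"
    unfolding B_def
    by (intro continuous_intros contp continuous_on_compose2[OF cont(3) contp pin])
  have der: "(F has_derivative (\<lambda>h. A z * h + B z * cnj h)) (at z)" for z
    using ahlfors_extension_has_derivative[OF holf \<open>R > 1\<close>] by (simp add: F_def A_def B_def p_def)
  have normB: "cmod (B z) = (1 - (cmod (p z))\<^sup>2) * cmod (p z * deriv (deriv f) (p z))" 
    if "cmod z > 1" for z
  proof -
    have "cmod (B z) = (cmod (z - p z) * (cmod (p z))\<^sup>2) * cmod (deriv (deriv f) (p z))"
      by (simp add: B_def norm_mult norm_power norm_minus_commute)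
    then show ?thesis
      using norm_diff_disc_reflection[OF that] by (simp add: p_def norm_mult)
  qed
  have pout: "cmod (p z) = inverse (cmod z)" if "cmod z > 1" for z
    using that by (simp add: p_def disc_reflection_def norm_inverse)
  have B_less_A: "cmod (B z) < cmod (A z)" for z
  proof (cases "cmod z \<le> 1")
    case True
    then show ?thesis using nz[of z] by (simp add: A_def B_def p_def disc_reflection_def)
  next
    case False
    then have "cmod (p z) < 1" using pout[of z] by (simp add: inverse_less_1_iff)
    then show ?thesis using less[of "p z"] normB[of z] False by (simp add: A_def)
  qed
  have bdd: "\<exists>K. \<forall>z. cmod z \<le> 1 \<longrightarrow> cmod (h z) \<le> K" if "continuous_on (cball 0 1) h" for h
    using compact_imp_bounded[OF compact_continuous_image[OF that compact_cball]]
    by (force simp: bounded_iff)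
  obtain K0 K1 K2 where K0: "\<And>z. cmod z \<le> 1 \<Longrightarrow> cmod (f z) \<le> K0"
    and K1: "\<And>z. cmod z \<le> 1 \<Longrightarrow> cmod (deriv f z) \<le> K1"
    and K2: "\<And>z. cmod z \<le> 1 \<Longrightarrow> cmod (deriv (deriv f) z) \<le> K2"
    using bdd cont by metis
  have K: "0 \<le> K0" "0 \<le> K1" "0 \<le> K2"
    using K0[of 0] K1[of 0] K2[of 0] norm_ge_zero order_trans by (metis norm_zero zero_le_one)+
  \<comment> \<open>At \<open>p z\<close> with |z| > 1 this gives the decay |A z - a| <= K2 /
    |z|.\<close>
  have lip: "cmod (deriv f z - a) \<le> K2 * cmod z" if "cmod z \<le> 1" for z
  proof -
    have "cmod (deriv f z - deriv f 0) \<le> K2 * cmod (z - 0)"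
      by (rule field_differentiable_bound[of "cball 0 1" _ "deriv (deriv f)"])
        (use that K2 sub holf' in \<open>auto intro!: holomorphic_derivI[where S = "ball 0 R"]\<close>)
    then show ?thesis by (simp add: a_def)
  qed
  \<comment> \<open>\<open>C\<close> adds the bounds for the three terms of
    \<open>F z - a * z\<close>: \<open>K0\<close> for \<open>f (p z)\<close>, \<open>K1\<close> for
    \<open>p z * A z\<close>, and \<open>K2 + K1 + cmod a\<close> for
    \<open>z * (A z - a)\<close>.\<close>
  define C where "C = K0 + 2 * K1 + K2 + cmod a"
  have C: "cmod (F z - a * z) \<le> C" for z
  proof -
    have zp: "cmod (z * (A z - a)) \<le> K2 + K1 + cmod a"
    proof (cases "cmod z \<le> 1")
      case True
      have "cmod (z * (A z - a)) \<le> 1 * (K1 + cmod a)"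
        unfolding norm_mult
        using True K1[OF p1] by (intro mult_mono order_trans[OF norm_triangle_ineq4]) (auto simp: A_def)
      then show ?thesis using K by simp
    next
      case False
      have "cmod (z * (A z - a)) \<le> cmod z * (K2 * cmod (p z))"
        unfolding norm_mult A_def by (intro mult_left_mono lip p1) auto
      also have "\<dots> = K2" using False pout[of z] by (cases "z = 0") auto
      finally show ?thesis using K by (simp add: add_increasing2)
    qed
    have pz: "cmod (p z * A z) \<le> 1 * K1"
      unfolding norm_mult A_def using p1 K1 by (intro mult_mono) auto
    have "F z - a * z = f (p z) - p z * A z + z * (A z - a)"
      by (simp add: F_def ahlfors_extension_def p_def A_def algebra_simps)
    then show ?thesis
      using K0[OF p1, of z] pz zp norm_triangle_ineq4[of "f (p z)" "p z * A z"]
        norm_triangle_ineq[of "f (p z) - p z * A z" "z * (A z - a)"]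
      by (simp add: C_def)
  qed
  have large: "cmod a * cmod z \<ge> cmod (F z) - C" for z
    using C[of z] norm_triangle_ineq2[of "F z" "a * z"] by (simp add: norm_mult)
  have large': "cmod a * cmod z \<le> cmod (F z) + C" for z
    using C[of z] norm_triangle_ineq2[of "a * z" "F z"] by (simp add: norm_mult norm_minus_commute)
  \<comment> \<open>The summand 2 keeps \<open>z\<close> outside the disc; 4 K2 / |a| makes 2 K2 /
    |z|, which bounds |A z - a| + |B z|, at most |a| / 2.\<close>
  define M where "M = 4 * K2 / cmod a + 2"
  have tail: "cmod (A z - a) + cmod (B z) \<le> cmod a / 2" if "cmod z \<ge> M" for z
  proof -
    have z2: "cmod z \<ge> 2" using that K by (auto simp: M_def intro: order_trans[rotated])
    then have pz: "cmod (p z) = inverse (cmod z)" using pout[of z] by simp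
    have "(1 - (cmod (p z))\<^sup>2) * (cmod (p z) * cmod (deriv (deriv f) (p z))) \<le> 1 * (cmod (p z) * K2)"
      using K K2[OF p1] by (intro mult_mono) auto
    then have "cmod (B z) \<le> cmod (p z) * K2"
      using z2 normB[of z] by (simp add: norm_mult)
    moreover have "cmod (A z - a) \<le> K2 * cmod (p z)" using lip[OF p1] by (simp add: A_def)
    moreover have "4 * K2 \<le> cmod a * cmod z"
      using that a0 by (simp add: M_def field_simps) (smt (verit) norm_ge_zero)
    then have "2 * (K2 * cmod (p z)) \<le> cmod a / 2"
      using z2 unfolding pz by (simp add: field_simps divide_le_eq)
    ultimately show ?thesis by (simp add: mult.commute)
  qed
  \<comment> \<open>A preimage \<open>x\<close> of \<open>w\<close> satisfies |a x| >= |a M| + 2 C,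
    and two preimages satisfy |a (x - y)| <= 2 C. Hence the segment between them stays in the region
    |s| >= M where \<open>tail\<close> applies.\<close>
  define w :: complex where "w = of_real (\<bar>cmod a * M\<bar> + 3 * C)"
  have C0: "C \<ge> 0" using K by (simp add: C_def)
  then have normw: "cmod w = \<bar>cmod a * M\<bar> + 3 * C"
    unfolding w_def by (simp del: of_real_add of_real_mult of_real_diff)
  have "inj F"
  proof (rule proper_locally_injective_imp_inj)
    show "continuous_on UNIV F"
      using der has_derivative_continuous by (blast intro: continuous_at_imp_continuous_on)
    show "\<exists>r>0. inj_on F (ball z r)" for z
      by (rule locally_injective_if_beltrami_less[OF der contA contB B_less_A])
    show "bounded {z. cmod (F z) \<le> D}" for D
      unfolding bounded_iff
    proof (intro exI ballI)
      fix z assume "z \<in> {z. cmod (F z) \<le> D}"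
      then have "cmod a * cmod z \<le> D + C" using large'[of z] by simp
      then show "cmod z \<le> (D + C) / cmod a" using a0 by (simp add: field_simps)
    qed
    show "x = y" if "F x = w" "F y = w" for x y
    proof (rule ccontr)
      assume "x \<noteq> y"
      define G where "G = (\<lambda>z. F z - a * z)"
      have Gxy: "G x - G y = - (a * (x - y))"
        using that by (simp add: G_def algebra_simps)
      have axy: "cmod (a * (x - y)) \<le> 2 * C"
        using C[of x] C[of y] norm_triangle_ineq4[of "G x" "G y"] unfolding Gxy by (simp add: G_def)
      have seg: "cmod s \<ge> M" if s: "s \<in> closed_segment x y" for s
      proof -
        have "cmod (a * (x - s)) \<le> cmod (a * (x - y))"
          using segment_bound[OF s] by (simp add: norm_mult norm_minus_commute mult_left_mono)
        moreover have "cmod (a * x) \<le> cmod (a * s) + cmod (a * (x - s))"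
          using norm_triangle_ineq[of "a * s" "a * (x - s)"] by (simp add: algebra_simps)
        ultimately have "cmod a * cmod s \<ge> cmod a * M"
          using axy large[of x] \<open>F x = w\<close> normw by (simp add: norm_mult)
        then show ?thesis using a0 by simp
      qed
      \<comment> \<open>On the segment the derivative of \<open>G\<close> has norm at most |a| / 2,
        whereas \<open>Gxy\<close> makes the increment of \<open>G\<close> have modulus exactly |a|
        |x - y|; for distinct \<open>x\<close> and \<open>y\<close> this is a contradiction.\<close>
      have "cmod (G x - G y) \<le> (cmod a / 2) * cmod (x - y)"
      proof (rule differentiable_bound[of "closed_segment x y"])
        fix s assume s: "s \<in> closed_segment x y"
        show "(G has_derivative (\<lambda>h. A s * h + B s * cnj h - a * h)) (at s within closed_segment x y)"
          unfolding G_def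
          by (rule has_derivative_at_withinI)
            (intro has_derivative_diff der has_derivative_mult_right has_derivative_ident)
        show "onorm (\<lambda>h. A s * h + B s * cnj h - a * h) \<le> cmod a / 2"
        proof (rule onorm_le)
          fix h
          have "cmod (A s * h + B s * cnj h - a * h) = cmod ((A s - a) * h + B s * cnj h)"
            by (simp add: algebra_simps)
          also have "\<dots> \<le> (cmod (A s - a) + cmod (B s)) * cmod h"
            by (rule order_trans[OF norm_triangle_ineq]) (simp add: norm_mult distrib_right)
          also have "\<dots> \<le> cmod a / 2 * cmod h"
            by (intro mult_right_mono tail seg s norm_ge_zero)
          finally show "cmod (A s * h + B s * cnj h - a * h) \<le> cmod a / 2 * cmod h" .
        qed
      qed auto
      then show False
        using a0 \<open>x \<noteq> y\<close> unfolding Gxy by (simp add: norm_mult)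
    qed
  qed
  then show ?thesis by (simp add: F_def)
qed

section \<open>Becker's univalence criterion\<close>

text \<open>Replacing f(z) by f(r z) with r < 1 gains analyticity beyond the unit circle and makes
  the inequality strict, as the extension argument requires.\<close>

theorem becker_univalence:
  assumes holf: "f holomorphic_on unit_disc"
    and nz: "\<And>z. z \<in> unit_disc \<Longrightarrow> deriv f z \<noteq> 0"
    and le: "\<And>z. z \<in> unit_disc \<Longrightarrow> (1 - (cmod z)\<^sup>2) * cmod (z * pre_Schwarzian f z) \<le> 1"
  shows "inj_on f unit_disc"
proof (rule inj_onI)
  fix x y assume xy: "x \<in> unit_disc" "y \<in> unit_disc" "f x = f y"
  \<comment> \<open>With \<open>r\<close> above both moduli, \<open>x / r\<close> and
    \<open>y / r\<close> still lie in the disc, so injectivity of the dilated function separates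
    \<open>x\<close> from \<open>y\<close>.\<close>
  obtain r where r: "max (cmod x) (cmod y) < r" "r < 1"
    using dense[of "max (cmod x) (cmod y)" 1] xy by auto
  have r0: "r > 0" using r norm_ge_zero[of x] by linarith
  define g where "g = (\<lambda>z. f (of_real r * z))"
  have in_disc: "of_real r * z \<in> unit_disc" if "cmod z < 1 / r" for z
    using that r0 by (simp add: norm_mult field_simps)
  have holg: "g holomorphic_on ball 0 (1 / r)"
    unfolding g_def
    by (intro holomorphic_on_compose_gen[OF _ holf, unfolded o_def] holomorphic_intros)
      (use in_disc in auto)
  have dg: "deriv g z = r * deriv f (r * z)" if "cmod z < 1 / r" for z :: complex
    unfolding g_def using in_disc[OF that] holf
    by (intro deriv_compose_linear) (auto intro: holomorphic_on_imp_differentiable_at)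
  have ddg: "deriv (deriv g) z = r\<^sup>2 * deriv (deriv f) (r * z)" if "cmod z < 1 / r" for z :: complex
  proof -
    have "deriv (deriv g) z = deriv (\<lambda>z. r * deriv f (r * z)) z"
    proof (rule deriv_cong_ev)
      have "\<forall>\<^sub>F u in nhds z. u \<in> ball 0 (1 / r)"
        by (rule eventually_nhds_in_open) (use that in auto)
      then show "\<forall>\<^sub>F u in nhds z. deriv g u = r * deriv f (r * u)"
        by eventually_elim (simp add: dg)
    qed simp
    also have "\<dots> = r * (r * deriv (deriv f) (r * z))"
    proof -
      have hol': "deriv f holomorphic_on unit_disc" by (simp add: holf holomorphic_deriv)
      have "(deriv f has_field_derivative deriv (deriv f) (r * z)) (at (r * z))"
        using in_disc[OF that] hol' by (auto intro!: holomorphic_derivI[where S = unit_disc])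
      then have "((\<lambda>z. r * deriv f (r * z)) has_field_derivative
          r * (deriv (deriv f) (r * z) * r)) (at z)"
        by (intro DERIV_cmult DERIV_chain2[where g = "\<lambda>z. r * z" and f = "deriv f"])
          (auto intro!: derivative_eq_intros)
      then show ?thesis by (simp add: DERIV_imp_deriv mult_ac)
    qed
    finally show ?thesis by (simp add: power2_eq_square)
  qed
  have le1: "cmod z < 1 / r" if "cmod z \<le> 1" for z
    using that r r0 by (simp add: field_simps) (smt (verit) mult_left_le)
  have "inj (ahlfors_extension g)"
  proof (rule inj_ahlfors_extension[OF holg])
    show "1 < 1 / r" using r r0 by simp
    show "deriv g z \<noteq> 0" if "cmod z \<le> 1" for z
      using dg nz in_disc le1[OF that] r0 by auto
    show "(1 - (cmod z)\<^sup>2) * cmod (z * deriv (deriv g) z) < cmod (deriv g z)" if z: "cmod z < 1" for z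
    proof (cases "z = 0")
      case True
      then show ?thesis using dg[of 0] nz[of 0] r0 by simp
    next
      case False
      define u where "u = of_real r * z"
      have zr: "cmod z < 1 / r" using le1 z by simp
      have u: "u \<in> unit_disc" "cmod u < cmod z"
        using in_disc[OF zr] r r0 False by (auto simp: u_def norm_mult)
      have nzu: "deriv f u \<noteq> 0" using nz u by blast
      have z1: "1 - (cmod z)\<^sup>2 > 0" using z by (simp add: power2_eq_1_iff abs_square_less_1)
      \<comment> \<open>Strictness comes from |u| < |z|, which needs z nonzero; where the second
        derivative term vanishes, it comes from f'(u) being nonzero instead.\<close>
      have lt: "1 - (cmod z)\<^sup>2 < 1 - (cmod u)\<^sup>2"
        using u(2) power_strict_mono[of "cmod u" "cmod z" 2] by simp
      have "(1 - (cmod z)\<^sup>2) * cmod (u * deriv (deriv f) u) < cmod (deriv f u)"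
      proof (cases "u * deriv (deriv f) u = 0")
        case False
        then have "(1 - (cmod z)\<^sup>2) * cmod (u * deriv (deriv f) u) <
          (1 - (cmod u)\<^sup>2) * cmod (u * deriv (deriv f) u)"
          using lt by (intro mult_strict_right_mono) auto
        also have "\<dots> \<le> cmod (deriv f u)"
          using le[OF u(1)] nzu
          by (simp add: pre_Schwarzian_def norm_mult norm_divide field_simps)
        finally show ?thesis .
      qed (use nzu in auto)
      \<comment> \<open>The factor \<open>r\<close> matches the dilation: g'(z) = r f'(u) and z
        g''(z) = r u f''(u).\<close>
      then have "r * ((1 - (cmod z)\<^sup>2) * cmod (u * deriv (deriv f) u)) < r * cmod (deriv f u)"
        using r0 by (rule mult_strict_left_mono)
      then show ?thesis
        using r0 by (simp add: dg[OF zr] ddg[OF zr] u_def norm_mult norm_power power2_eq_square mult_ac)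
    qed
  qed
  moreover have "ahlfors_extension g (v / r) = f v" if "cmod v < r" for v
    using that r0 by (simp add: ahlfors_extension_def disc_reflection_def g_def norm_divide field_simps)
  ultimately have "x / of_real r = y / of_real r"
    using xy(3) r by (metis injD max_less_iff_conj)
  then show "x = y" using r0 by simp
qed

section \<open>The pre-Schwarzian bound from the half-plane condition\<close>

text \<open>The Schwarz lemma gives |g| <= |z| |2c - g|; the triangle inequality and collecting the
  terms in |g| finish. The factor 1 - |z| is kept on the left, ready to be completed to 1 -
  |z|^2.\<close>

lemma borel_caratheodory_zero:
  fixes g :: "complex \<Rightarrow> complex"
  assumes holg: "g holomorphic_on unit_disc" and g0: "g 0 = 0"
    and Re: "\<And>z. z \<in> unit_disc \<Longrightarrow> Re (g z) < c" and z: "z \<in> unit_disc"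
  shows "cmod (g z) * (1 - cmod z) \<le> 2 * c * cmod z"
proof -
  \<comment> \<open>the Moebius map \<open>\<zeta> / (2c - \<zeta>)\<close> sends the half-plane \<open>Re \<zeta> < c\<close> to the unit disc\<close>
  define w where "w = (\<lambda>z. g z / (of_real (2 * c) - g z))"
  have c: "c > 0" using Re[of 0] g0 by simp
  have nz: "of_real (2 * c) - g u \<noteq> 0" if "u \<in> unit_disc" for u
    using Re[OF that] c by (auto simp: complex_eq_iff)
  have w1: "cmod (w u) < 1" if "cmod u < 1" for u
  proof -
    have "(cmod (g u))\<^sup>2 < (cmod (of_real (2 * c) - g u))\<^sup>2"
    proof -
      have "(cmod (of_real (2 * c) - g u))\<^sup>2 - (cmod (g u))\<^sup>2 = 4 * c * (c - Re (g u))"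
        by (simp add: cmod_power2) (simp add: power2_eq_square algebra_simps)
      moreover have "\<dots> > 0" using c Re[of u] that by simp
      ultimately show ?thesis by linarith
    qed
    then have "cmod (g u) < cmod (of_real (2 * c) - g u)"
      by (rule power_less_imp_less_base) simp
    then show ?thesis
      using nz[of u] that by (simp add: w_def norm_divide divide_less_eq)
  qed
  have "cmod (w z) \<le> cmod z"
  proof (rule Schwarz_Lemma(1))
    show "w holomorphic_on unit_disc"
      unfolding w_def using nz by (intro holomorphic_intros holg) auto
  qed (use z w1 g0 in \<open>auto simp: w_def\<close>)
  then have "cmod (g z) \<le> cmod z * cmod (of_real (2 * c) - g z)"
    using nz[OF z] by (simp add: w_def norm_divide divide_le_eq)
  also have "\<dots> \<le> cmod z * (2 * c + cmod (g z))"
    using c norm_triangle_ineq4[of "of_real (2 * c)" "g z"] by (intro mult_left_mono) auto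
  finally show ?thesis by (simp add: algebra_simps)
qed

lemma class_C_pre_Schwarzian_bound:
  assumes f: "f \<in> class_C \<theta> \<gamma>" and "\<bar>\<theta>\<bar> < pi / 2" "\<gamma> > 0" and z: "z \<in> unit_disc"
  shows "(1 - (cmod z)\<^sup>2) * cmod (z * pre_Schwarzian f z) \<le> 2 * \<gamma> * cos \<theta>"
proof -
  define g where "g = (\<lambda>z. exp (\<i> * of_real \<theta>) * (z * pre_Schwarzian f z))"
  \<comment> \<open>What remains of (1 + gamma / 2) cos(theta) after subtracting cos(theta), the
    real part of exp(i theta).\<close>
  define c where "c = \<gamma> * cos \<theta> / 2"
  have cos: "cos \<theta> > 0" using assms(2) by (intro cos_gt_zero_pi) auto
  have holf: "f holomorphic_on unit_disc" and nz: "\<And>u. u \<in> unit_disc \<Longrightarrow> deriv f u \<noteq> 0"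
    and Re: "\<And>u. u \<in> unit_disc \<Longrightarrow>
      Re (exp (\<i> * of_real \<theta>) * (1 + u * deriv (deriv f) u / deriv f u)) < (1 + \<gamma> / 2) * cos \<theta>"
    using f by (auto simp: class_C_def class_A_def)
  have holg: "g holomorphic_on unit_disc"
    unfolding g_def pre_Schwarzian_def
    by (intro holomorphic_intros holomorphic_deriv holf nz) auto
  have "Re (g u) < c" if "u \<in> unit_disc" for u
    using Re[OF that]
    by (simp add: g_def c_def pre_Schwarzian_def distrib_left distrib_right Re_exp)
  then have "cmod (g z) * (1 - cmod z) \<le> 2 * c * cmod z"
    using borel_caratheodory_zero[OF holg _ _ z] by (simp add: g_def)
  \<comment> \<open>The factor 1 + |z| completes 1 - |z| to 1 - |z|^2. On the right, 1 + |z| <= 2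
    and |z| <= 1 leave 4 c = 2 gamma cos(theta).\<close>
  then have "(1 + cmod z) * (cmod (g z) * (1 - cmod z)) \<le> (1 + cmod z) * (2 * c * cmod z)"
    by (intro mult_left_mono) auto
  also have "\<dots> \<le> 2 * (2 * c * 1)"
    using z cos \<open>\<gamma> > 0\<close> by (intro mult_mono) (auto simp: c_def)
  finally have "(1 - (cmod z)\<^sup>2) * cmod (g z) \<le> 2 * \<gamma> * cos \<theta>"
    by (simp add: c_def power2_eq_square algebra_simps)
  then show ?thesis by (simp add: g_def norm_mult)
qed

theorem mainTheorem5:
  fixes \<theta> \<gamma> :: real
  assumes "\<bar>\<theta>\<bar> < pi / 2" and "\<gamma> > 0"
  shows "(\<forall>f\<in>class_C \<theta> \<gamma>.
            (SUP z\<in>unit_disc. ereal ((1 - (cmod z)\<^sup>2) * cmod (z * pre_Schwarzian f z)))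
              \<le> ereal (2 * \<gamma> * cos \<theta>))
       \<and> (2 * \<gamma> * cos \<theta> \<le> 1 \<longrightarrow> (\<forall>f\<in>class_C \<theta> \<gamma>. inj_on f unit_disc))
       \<and> (\<gamma> \<le> 1 / 2 \<longrightarrow> (\<forall>f\<in>class_C 0 \<gamma>. inj_on f unit_disc))"
proof -
  \<comment> \<open>The angle is left general so that this applies both to the given one and to 0,
    where cos 0 = 1 turns the condition into gamma <= 1/2.\<close>
  have univalent: "inj_on f unit_disc"
    if f: "f \<in> class_C \<phi> \<gamma>" and "\<bar>\<phi>\<bar> < pi / 2" "2 * \<gamma> * cos \<phi> \<le> 1" for f \<phi>
  proof (rule becker_univalence)
    show "f holomorphic_on unit_disc" "\<And>z. z \<in> unit_disc \<Longrightarrow> deriv f z \<noteq> 0"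
      using f by (auto simp: class_C_def class_A_def)
  qed (use class_C_pre_Schwarzian_bound[OF f that(2) assms(2)] that(3) in \<open>force intro: order_trans\<close>)
  show ?thesis
    using class_C_pre_Schwarzian_bound assms univalent
    by (auto intro!: SUP_least simp del: norm_mult)
qed

end
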